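(* System (S$_\lambda$) is definite on $\mathbb{N}_0$ if and only if for any $\{\tilde z,\tilde f\}\in T_{\max}$ there exists a unique $u\in\tilde z$ such that $\mathscr{L}(u)=\Psi f$.
   Context: Let $n\in\mathbb{N}$, $\mathbb{N}_0=\{0,1,2,\dots\}$ and $\mathcal{J}=\begin{pmatrix}0&I_n\\-I_n&0\end{pmatrix}$. For each $k\in\mathbb{N}_0$ let $S_k,\Psi_k\in\mathbb{C}^{2n\times2n}$ satisfy $S_k^*\mathcal{J}S_k=\mathcal{J}$, $\Psi_k^*=\Psi_k\ge0$ (positive semi-definite) and $\Psi_k\mathcal{J}\Psi_k=0$. Put $V_k=-\mathcal{J}\Psi_kS_k$ and $\mathbb{S}_k(\lambda)=S_k+\lambda V_k$, $\lambda\in\mathbb{C}$; these matrices are invertible. System (S$_\lambda$) is $z_k=\mathbb{S}_k(\lambda)z_{k+1}$, $k\in\mathbb{N}_0$. It is definite on $\mathbb{N}_0$ if for each $\lambda\in\mathbb{C}$ and every nontrivial solution $z(\lambda)$ of (S$_\lambda$) one has $\sum_{k\in\mathbb{N}_0}z_k^*(\lambda)\Psi_kz_k(\lambda)>0$. For a sequence $z=(z_k)_{k\in\mathbb{N}_0}$ in $\mathbb{C}^{2n}$ put $\mathscr{L}(z)_k=\mathcal{J}(z_k-S_kz_{k+1})$; $\mathscr{L}(z)=\Psi f$ means $\mathscr{L}(z)_k=\Psi_kf_k$ for all $k\in\mathbb{N}_0$. $\|z\|_\Psi=\big(\sum_{k=0}^\infty z_k^*\Psi_kz_k\big)^{1/2}$,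 $\ell^2_\Psi(\mathbb{N}_0)$ is the space of sequences in $\mathbb{C}^{2n}$ with $\|z\|_\Psi<\infty$, and $\tilde\ell^2_\Psi(\mathbb{N}_0)$ is the Hilbert space obtained as its quotient by $\{z:\|z\|_\Psi=0\}$; classes are denoted $\tilde z$. The maximal linear relation is $T_{\max}=\{\{\tilde z,\tilde f\}\in\tilde\ell^2_\Psi(\mathbb{N}_0)\times\tilde\ell^2_\Psi(\mathbb{N}_0):\exists\,u\in\tilde z\text{ with }\mathscr{L}(u)=\Psi f\}$ ($\Psi f$ does not depend on the representative $f\in\tilde f$). *)

theory Defs
  imports "HOL-Analysis.Analysis"
begin

text \<open>
  The index type \<open>'n + 'n\<close> models \<open>{1, \<dots>, 2n}\<close> split into two blocks of size \<open>n = CARD('n)\<close>;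
  as types are nonempty, \<open>n \<ge> 1\<close>.
\<close>

type_synonym 'n cvec = "complex ^ ('n + 'n)"
type_synonym 'n cmat = "complex ^ ('n + 'n) ^ ('n + 'n)"

definition symp_J :: "('n::finite) cmat" where
  "symp_J = (\<chi> i j. case (i, j) of
      (Inl a, Inr b) \<Rightarrow> (if a = b then 1 else 0)
    | (Inr a, Inl b) \<Rightarrow> (if a = b then -1 else 0)
    | _ \<Rightarrow> 0)"

definition conj_transpose :: "complex ^ 'm ^ 'k \<Rightarrow> complex ^ 'k ^ 'm" where
  "conj_transpose A = (\<chi> i j. cnj (A $ j $ i))"

text \<open>The number \<open>z\<^sup>* A z\<close>.\<close>

definition quad_form :: "complex ^ 'm ^ 'm \<Rightarrow> complex ^ 'm \<Rightarrow> complex" where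
  "quad_form A z = (\<Sum>i\<in>UNIV. cnj (z $ i) * (A *v z) $ i)"

text \<open>
  For a Hermitian matrix the quadratic form is real-valued, so only its real part is constrained.
\<close>

definition pos_semidef :: "complex ^ 'm ^ 'm \<Rightarrow> bool" where
  "pos_semidef A \<longleftrightarrow> conj_transpose A = A \<and> (\<forall>z. Re (quad_form A z) \<ge> 0)"

definition V_mat :: "(nat \<Rightarrow> ('n::finite) cmat) \<Rightarrow> (nat \<Rightarrow> 'n cmat) \<Rightarrow> nat \<Rightarrow> 'n cmat" where
  "V_mat S \<Psi> k = - (symp_J ** \<Psi> k ** S k)"

definition S_lam ::
  "(nat \<Rightarrow> ('n::finite) cmat) \<Rightarrow> (nat \<Rightarrow> 'n cmat) \<Rightarrow> nat \<Rightarrow> complex \<Rightarrow> 'n cmat" where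
  "S_lam S \<Psi> k lam = S k + (\<chi> i j. lam * V_mat S \<Psi> k $ i $ j)"

definition solves_system ::
  "(nat \<Rightarrow> ('n::finite) cmat) \<Rightarrow> (nat \<Rightarrow> 'n cmat) \<Rightarrow> complex \<Rightarrow> (nat \<Rightarrow> 'n cvec) \<Rightarrow> bool" where
  "solves_system S \<Psi> lam z \<longleftrightarrow> (\<forall>k. z k = S_lam S \<Psi> k lam *v z (Suc k))"

text \<open>
  The series \<open>\<Sum>k. z\<^sub>k\<^sup>* \<Psi>\<^sub>k z\<^sub>k\<close>. Its terms are nonnegative reals when every \<open>\<Psi>\<^sub>k\<close> is positive
  semi-definite; the value \<open>\<infinity>\<close> stands for divergence.
\<close>

definition psi_series :: "(nat \<Rightarrow> ('n::finite) cmat) \<Rightarrow> (nat \<Rightarrow> 'n cvec) \<Rightarrow> ennreal" where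
  "psi_series \<Psi> z = (\<Sum>k. ennreal (Re (quad_form (\<Psi> k) (z k))))"

definition definite_system ::
  "(nat \<Rightarrow> ('n::finite) cmat) \<Rightarrow> (nat \<Rightarrow> 'n cmat) \<Rightarrow> bool" where
  "definite_system S \<Psi> \<longleftrightarrow>
    (\<forall>lam z. solves_system S \<Psi> lam z \<and> z \<noteq> (\<lambda>k. 0) \<longrightarrow> psi_series \<Psi> z > 0)"

definition psi_norm :: "(nat \<Rightarrow> ('n::finite) cmat) \<Rightarrow> (nat \<Rightarrow> 'n cvec) \<Rightarrow> ennreal" where
  "psi_norm \<Psi> z =
    (if psi_series \<Psi> z = \<infinity> then \<infinity> else ennreal (sqrt (enn2real (psi_series \<Psi> z))))"

definition ell2 :: "(nat \<Rightarrow> ('n::finite) cmat) \<Rightarrow> (nat \<Rightarrow> 'n cvec) set" where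
  "ell2 \<Psi> = {z. psi_norm \<Psi> z < \<infinity>}"

definition psi_rel ::
  "(nat \<Rightarrow> ('n::finite) cmat) \<Rightarrow> ((nat \<Rightarrow> 'n cvec) \<times> (nat \<Rightarrow> 'n cvec)) set" where
  "psi_rel \<Psi> = {(z, w). z \<in> ell2 \<Psi> \<and> w \<in> ell2 \<Psi> \<and> psi_norm \<Psi> (\<lambda>k. z k - w k) = 0}"

definition ell2_quot :: "(nat \<Rightarrow> ('n::finite) cmat) \<Rightarrow> (nat \<Rightarrow> 'n cvec) set set" where
  "ell2_quot \<Psi> = ell2 \<Psi> // psi_rel \<Psi>"

definition L_op :: "(nat \<Rightarrow> ('n::finite) cmat) \<Rightarrow> (nat \<Rightarrow> 'n cvec) \<Rightarrow> nat \<Rightarrow> 'n cvec" where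
  "L_op S z k = symp_J *v (z k - S k *v z (Suc k))"

text \<open>
  \<open>L_eq S \<Psi> u F\<close> is the equation \<open>\<L>(u) = \<Psi> f\<close> for a class \<open>F\<close>. Which \<open>f \<in> F\<close> is used
  is irrelevant, see \<open>L_eq_iff\<close> below; classes are nonempty, so the quantifier is not vacuous.
\<close>

definition L_eq ::
  "(nat \<Rightarrow> ('n::finite) cmat) \<Rightarrow> (nat \<Rightarrow> 'n cmat) \<Rightarrow> (nat \<Rightarrow> 'n cvec) \<Rightarrow> (nat \<Rightarrow> 'n cvec) set \<Rightarrow> bool"
  where "L_eq S \<Psi> u F \<longleftrightarrow> (\<forall>f\<in>F. \<forall>k. L_op S u k = \<Psi> k *v f k)"

definition T_max ::
  "(nat \<Rightarrow> ('n::finite) cmat) \<Rightarrow> (nat \<Rightarrow> 'n cmat) \<Rightarrow>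
    ((nat \<Rightarrow> 'n cvec) set \<times> (nat \<Rightarrow> 'n cvec) set) set" where
  "T_max S \<Psi> = {(Z, F). Z \<in> ell2_quot \<Psi> \<and> F \<in> ell2_quot \<Psi> \<and> (\<exists>u\<in>Z. L_eq S \<Psi> u F)}"

definition sesq :: "complex ^ 'm ^ 'm \<Rightarrow> complex ^ 'm \<Rightarrow> complex ^ 'm \<Rightarrow> complex" where
  "sesq A v w = (\<Sum>i\<in>UNIV. cnj (v $ i) * (A *v w) $ i)"

lemma sesq_cnj:
  assumes "conj_transpose A = A"
  shows "sesq A w v = cnj (sesq A v w)"
proof -
  have A: "A $ i $ j = cnj (A $ j $ i)" for i j
  proof -
    have "A $ i $ j = conj_transpose A $ i $ j" by (simp only: assms)
    then show ?thesis by (simp only: conj_transpose_def vec_lambda_beta)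
  qed
  have "sesq A w v = (\<Sum>i\<in>UNIV. \<Sum>j\<in>UNIV. cnj (w $ i) * (A $ i $ j * v $ j))"
    by (simp add: sesq_def matrix_vector_mult_def sum_distrib_left)
  also have "\<dots> = (\<Sum>j\<in>UNIV. \<Sum>i\<in>UNIV. cnj (w $ i) * (A $ i $ j * v $ j))"
    by (rule sum.swap)
  also have "\<dots> = cnj (sesq A v w)"
  proof -
    have "cnj (w $ i) * (A $ i $ j * v $ j) = cnj (cnj (v $ j) * (A $ j $ i * w $ i))" for i j
      by (subst A[of i j]) (simp add: mult_ac)
    then show ?thesis
      by (simp only: sesq_def matrix_vector_mult_def vec_lambda_beta sum_distrib_left cnj_sum)
  qed
  finally show ?thesis .
qed

lemma sesq_expand:
  fixes v w :: "complex ^ 'm"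
  shows "sesq A (v + c *s w) (v + c *s w)
    = sesq A v v + c * sesq A v w + cnj c * sesq A w v + cnj c * c * sesq A w w"
proof -
  have "(A *v (v + c *s w)) $ i = (A *v v) $ i + c * (A *v w) $ i" for i
    by (simp only: matrix_vector_right_distrib vector_scalar_commute
        vector_add_component vector_smult_component)
  then have "sesq A (v + c *s w) (v + c *s w)
      = (\<Sum>i\<in>UNIV. cnj (v $ i) * (A *v v) $ i + c * (cnj (v $ i) * (A *v w) $ i)
          + cnj c * (cnj (w $ i) * (A *v v) $ i) + cnj c * c * (cnj (w $ i) * (A *v w) $ i))"
    unfolding sesq_def by (intro sum.cong refl) (simp add: ring_distribs mult_ac)
  then show ?thesis
    unfolding sesq_def sum.distrib sum_distrib_left .
qed

lemma pos_semidef_null: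
  assumes "pos_semidef A" "Re (quad_form A v) = 0"
  shows "A *v v = 0"
proof -
  have h: "conj_transpose A = A" and p: "\<And>z. Re (sesq A z z) \<ge> 0"
    using assms(1) by (auto simp: pos_semidef_def quad_form_def sesq_def)
  have z: "Re (sesq A v v) = 0"
    using assms(2) by (simp add: quad_form_def sesq_def)
  define w where "w = A *v v"
  define N where "N = (\<Sum>i\<in>UNIV. (cmod (w $ i))\<^sup>2)"
  have wv: "sesq A w v = of_real N"
    unfolding sesq_def N_def w_def[symmetric] of_real_sum
    by (intro sum.cong refl) (simp add: complex_norm_square[symmetric] mult.commute)
  have vw: "sesq A v w = of_real N"
    using sesq_cnj[OF h, of v w] wv by simp
  define M where "M = Re (sesq A w w)"
  have ineq: "2 * t * N + t\<^sup>2 * M \<ge> 0" for t :: real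
  proof -
    have "Re (sesq A (v + of_real t *s w) (v + of_real t *s w)) = 2 * t * N + t\<^sup>2 * M"
      by (simp add: sesq_expand wv vw z M_def power2_eq_square)
    then show ?thesis using p[of "v + of_real t *s w"] by simp
  qed
  have "N \<ge> 0" unfolding N_def by (simp add: sum_nonneg)
  have "M \<ge> 0" unfolding M_def using p by simp
  have "N = 0"
  proof (rule ccontr)
    assume "N \<noteq> 0"
    then have "N > 0" using \<open>N \<ge> 0\<close> by simp
    define t where "t = - N / (M + 1)"
    have t: "t < 0" using \<open>N > 0\<close> \<open>M \<ge> 0\<close> by (simp add: t_def)
    have "t * M \<ge> - N" using \<open>N > 0\<close> \<open>M \<ge> 0\<close> by (simp add: t_def field_simps)
    then have "2 * N + t * M > 0" using \<open>N > 0\<close> by linarith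
    then have "t * (2 * N + t * M) < 0" using t by (simp add: mult_neg_pos)
    then show False using ineq[of t] by (simp add: algebra_simps power2_eq_square)
  qed
  then have "\<forall>i. (cmod (w $ i))\<^sup>2 = 0"
    unfolding N_def by (subst (asm) sum_nonneg_eq_0_iff) auto
  then show ?thesis by (simp add: w_def vec_eq_iff)
qed

lemma pos_semidef_null_iff:
  assumes "pos_semidef A"
  shows "ennreal (Re (quad_form A v)) = 0 \<longleftrightarrow> A *v v = 0"
proof
  assume "ennreal (Re (quad_form A v)) = 0"
  then have "Re (quad_form A v) = 0"
    using assms by (simp add: pos_semidef_def ennreal_eq_0_iff order_antisym)
  then show "A *v v = 0" by (rule pos_semidef_null[OF assms])
next
  assume "A *v v = 0"
  then show "ennreal (Re (quad_form A v)) = 0" by (simp add: quad_form_def)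
qed

lemma psi_norm_zero_iff:
  assumes "\<forall>k. pos_semidef (\<Psi> k)"
  shows "psi_norm \<Psi> z = 0 \<longleftrightarrow> (\<forall>k. \<Psi> k *v z k = 0)"
proof -
  have "psi_norm \<Psi> z = 0 \<longleftrightarrow> psi_series \<Psi> z = 0"
    by (auto simp: psi_norm_def enn2real_eq_0_iff)
  also have "\<dots> \<longleftrightarrow> (\<forall>k. ennreal (Re (quad_form (\<Psi> k) (z k))) = 0)"
    unfolding psi_series_def by (subst suminf_eq_zero_iff) auto
  also have "\<dots> \<longleftrightarrow> (\<forall>k. \<Psi> k *v z k = 0)"
    by (simp only: pos_semidef_null_iff[OF assms[THEN spec]])
  finally show ?thesis .
qed

lemma psi_rel_iff:
  assumes "\<forall>k. pos_semidef (\<Psi> k)"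
  shows "(z, w) \<in> psi_rel \<Psi> \<longleftrightarrow> z \<in> ell2 \<Psi> \<and> w \<in> ell2 \<Psi> \<and> (\<forall>k. \<Psi> k *v z k = \<Psi> k *v w k)"
  unfolding psi_rel_def
  by (simp add: psi_norm_zero_iff[OF assms] matrix_vector_mult_diff_distrib)

lemma equiv_psi_rel:
  assumes "\<forall>k. pos_semidef (\<Psi> k)"
  shows "equiv (ell2 \<Psi>) (psi_rel \<Psi>)"
proof (rule equivI)
  show "psi_rel \<Psi> \<subseteq> ell2 \<Psi> \<times> ell2 \<Psi>"
    by (auto simp: psi_rel_def)
  show "refl_on (ell2 \<Psi>) (psi_rel \<Psi>)"
    by (rule refl_onI) (simp only: psi_rel_iff[OF assms] simp_thms)
  show "sym (psi_rel \<Psi>)"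
    by (rule symI) (simp only: psi_rel_iff[OF assms] simp_thms)
  show "trans (psi_rel \<Psi>)"
    by (rule transI) (simp only: psi_rel_iff[OF assms] simp_thms)
qed

lemma L_eq_iff:
  assumes "\<forall>k. pos_semidef (\<Psi> k)" "F \<in> ell2_quot \<Psi>" "f \<in> F"
  shows "L_eq S \<Psi> u F \<longleftrightarrow> (\<forall>k. L_op S u k = \<Psi> k *v f k)"
proof -
  have "\<forall>k. \<Psi> k *v g k = \<Psi> k *v f k" if "g \<in> F" for g
  proof -
    have "(g, f) \<in> psi_rel \<Psi>"
      using quotient_eq_iff[OF equiv_psi_rel[OF assms(1)], of F F g f] assms(2,3) that
      unfolding ell2_quot_def by simp
    then show ?thesis by (simp only: psi_rel_iff[OF assms(1)] simp_thms)
  qed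
  then have "L_eq S \<Psi> u F \<longleftrightarrow> (\<forall>g\<in>F. \<forall>k. L_op S u k = \<Psi> k *v f k)"
    unfolding L_eq_def by (intro ball_cong refl) (simp only: simp_thms)
  then show ?thesis using assms(3) by blast
qed

end

(* Since \<Psi> J \<Psi> = 0, a solution z of the system for any \<lambda> has \<Psi>\<^sub>k z\<^sub>k = \<Psi>\<^sub>k S\<^sub>k z\<^sub>k\<^sub>+\<^sub>1. If its
   seminorm vanishes, the \<lambda>-term therefore drops out. So the system is indefinite iff some
   nonzero z satisfies L(z) = 0 and \<Psi> z = 0, and these z are the possible differences of two
   representatives of the same class that solve L(u) = \<Psi> f. *)

theory Submission
  imports Defs
begin

text \<open>Multiplication by J swaps the two halves of a vector up to sign, so no entry is lost.
  This is what allows J to be cancelled from the equation L(z) = 0.\<close>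

lemma symp_J_eq_0_iff:
  fixes v :: "('n::finite) cvec"
  shows "symp_J *v v = 0 \<longleftrightarrow> v = 0"
proof
  assume J: "symp_J *v v = 0"
  have sum: "(symp_J *v v) $ i = (\<Sum>a\<in>UNIV. symp_J $ i $ Inl a * v $ Inl a)
      + (\<Sum>b\<in>UNIV. symp_J $ i $ Inr b * v $ Inr b)" for i
    unfolding matrix_vector_mult_def
    by (simp add: UNIV_Plus_UNIV[symmetric] sum.Plus del: UNIV_Plus_UNIV)
  have "(symp_J *v v) $ Inl a = v $ Inr a" for a
    unfolding sum by (simp add: symp_J_def if_distrib[of "\<lambda>x. x * _"] cong: if_cong)
  moreover have "(symp_J *v v) $ Inr a = - v $ Inl a" for a
    unfolding sum by (simp add: symp_J_def if_distrib[of "\<lambda>x. x * _"] cong: if_cong)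
  ultimately have "v $ Inr a = 0" "v $ Inl a = 0" for a
    using J by (metis zero_index, metis zero_index neg_equal_0_iff_equal)
  then have "v $ i = 0" for i by (cases i) auto
  then show "v = 0" by (simp add: vec_eq_iff)
qed simp

lemma L_op_eq_0_iff: "L_op S z k = 0 \<longleftrightarrow> z k = S k *v z (Suc k)"
  by (simp add: L_op_def symp_J_eq_0_iff)

lemma L_op_diff: "L_op S (\<lambda>k. u k - w k) k = L_op S u k - L_op S w k"
  by (simp add: L_op_def matrix_vector_mult_diff_distrib)

text \<open>In this form the \<open>lam\<close>-term depends on \<open>w\<close> only through
  \<open>\<Psi> k *v (S k *v w)\<close>. It vanishes when that vector does, and its outer factor J
  is exposed to a further \<Psi> from the left.\<close>

lemma S_lam_mult_vec:
  fixes S \<Psi> :: "nat \<Rightarrow> ('n::finite) cmat"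
  shows "S_lam S \<Psi> k lam *v w = S k *v w - lam *s (symp_J *v (\<Psi> k *v (S k *v w)))"
proof -
  have "(\<chi> i j. lam * V_mat S \<Psi> k $ i $ j) *v w = lam *s (V_mat S \<Psi> k *v w)"
    by (simp add: matrix_vector_mult_def vec_eq_iff sum_distrib_left mult.assoc)
  moreover have "V_mat S \<Psi> k *v w = - ((symp_J ** \<Psi> k ** S k) *v w)"
    by (simp add: V_mat_def matrix_vector_mult_def vec_eq_iff sum_negf)
  ultimately show ?thesis
    by (simp add: S_lam_def matrix_vector_mult_add_rdistrib matrix_vector_mul_assoc
        matrix_mul_assoc vec_eq_iff)
qed

lemma psi_series_eq_0_iff:
  assumes "\<forall>k. pos_semidef (\<Psi> k)"
  shows "psi_series \<Psi> z = 0 \<longleftrightarrow> (\<forall>k. \<Psi> k *v z k = 0)"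
proof -
  have "psi_series \<Psi> z = 0 \<longleftrightarrow> psi_norm \<Psi> z = 0"
    by (auto simp: psi_norm_def enn2real_eq_0_iff)
  then show ?thesis by (simp only: psi_norm_zero_iff[OF assms])
qed

text \<open>The right-hand side is free of \<open>lam\<close>: a solution of zero seminorm for one
  value of the parameter is one for every value.\<close>

lemma null_solution_iff:
  fixes S \<Psi> :: "nat \<Rightarrow> ('n::finite) cmat"
  assumes "\<forall>k. pos_semidef (\<Psi> k)" and "\<And>k. \<Psi> k ** symp_J ** \<Psi> k = 0"
  shows "solves_system S \<Psi> lam z \<and> psi_series \<Psi> z = 0 \<longleftrightarrow>
    (\<forall>k. L_op S z k = 0) \<and> (\<forall>k. \<Psi> k *v z k = 0)"
proof -
  have "z k = S_lam S \<Psi> k lam *v z (Suc k) \<longleftrightarrow> z k = S k *v z (Suc k)" if z: "\<Psi> k *v z k = 0" for k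
  proof
    let ?w = "S k *v z (Suc k)"
    assume eq: "z k = S_lam S \<Psi> k lam *v z (Suc k)"
    \<comment> \<open>Applying \<open>\<Psi> k\<close> to the equation kills the
      \<open>lam\<close>-term before anything is known about \<open>?w\<close>. Only then does
      \<open>\<Psi> k *v z k = 0\<close> carry over to \<open>?w\<close> and remove that term from
      the equation itself.\<close>
    have "\<Psi> k *v (symp_J *v (\<Psi> k *v ?w)) = (\<Psi> k ** symp_J ** \<Psi> k) *v ?w"
      by (simp only: matrix_vector_mul_assoc matrix_mul_assoc)
    also have "\<dots> = 0"
      by (simp only: assms(2) matrix_vector_mult_0)
    finally have "\<Psi> k *v z k = \<Psi> k *v ?w"
      by (simp add: eq S_lam_mult_vec matrix_vector_mult_diff_distrib vector_scalar_commute)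
    then have "\<Psi> k *v ?w = 0" using z by simp
    then show "z k = ?w" by (simp add: eq S_lam_mult_vec)
  next
    assume eq: "z k = S k *v z (Suc k)"
    then have "\<Psi> k *v (S k *v z (Suc k)) = 0" using z by simp
    then show "z k = S_lam S \<Psi> k lam *v z (Suc k)"
      by (simp add: S_lam_mult_vec eq)
  qed
  then show ?thesis
    unfolding solves_system_def psi_series_eq_0_iff[OF assms(1)] L_op_eq_0_iff by blast
qed

lemma definite_system_iff:
  fixes S \<Psi> :: "nat \<Rightarrow> ('n::finite) cmat"
  assumes "\<forall>k. pos_semidef (\<Psi> k)" and "\<And>k. \<Psi> k ** symp_J ** \<Psi> k = 0"
  shows "definite_system S \<Psi> \<longleftrightarrow>
    (\<forall>z. (\<forall>k. L_op S z k = 0) \<and> (\<forall>k. \<Psi> k *v z k = 0) \<longrightarrow> z = (\<lambda>k. 0))"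
proof -
  have "definite_system S \<Psi> \<longleftrightarrow>
      (\<forall>lam z. solves_system S \<Psi> lam z \<and> psi_series \<Psi> z = 0 \<longrightarrow> z = (\<lambda>k. 0))"
    unfolding definite_system_def zero_less_iff_neq_zero by blast
  then show ?thesis
    unfolding null_solution_iff[OF assms] by blast
qed

text \<open>Membership in \<open>psi_rel\<close> includes membership in \<open>ell2\<close>. This
  lemma makes the zero class consist of all sequences annihilated by \<Psi>.\<close>

lemma null_sequence_in_ell2:
  assumes "\<forall>k. pos_semidef (\<Psi> k)" and "\<forall>k. \<Psi> k *v z k = 0"
  shows "z \<in> ell2 \<Psi>"
proof -
  have "psi_norm \<Psi> z = 0"
    using assms(2) by (simp only: psi_norm_zero_iff[OF assms(1)] simp_thms)
  then show ?thesis by (simp add: ell2_def)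
qed

theorem theorem5p2:
  fixes S \<Psi> :: "nat \<Rightarrow> ('n::finite) cmat"
  assumes "\<And>k. conj_transpose (S k) ** symp_J ** S k = symp_J"
    and "\<And>k. pos_semidef (\<Psi> k)"
    and "\<And>k. \<Psi> k ** symp_J ** \<Psi> k = 0"
  shows "definite_system S \<Psi> \<longleftrightarrow>
    (\<forall>(Z, F) \<in> T_max S \<Psi>. \<exists>!u. u \<in> Z \<and> L_eq S \<Psi> u F)"
proof -
  have psd: "\<forall>k. pos_semidef (\<Psi> k)" using assms(2) by blast
  note equiv = equiv_psi_rel[OF psd] and def_iff = definite_system_iff[OF psd assms(3), of S]
  show ?thesis
  proof
    assume D: "definite_system S \<Psi>"
    have "u = w" if ZF: "(Z, F) \<in> T_max S \<Psi>"
      and u: "u \<in> Z" "L_eq S \<Psi> u F" and w: "w \<in> Z" "L_eq S \<Psi> w F" for Z F u w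
    proof -
      have Z: "Z \<in> ell2 \<Psi> // psi_rel \<Psi>" and F: "F \<in> ell2 \<Psi> // psi_rel \<Psi>"
        using ZF by (auto simp: T_max_def ell2_quot_def)
      \<comment> \<open>\<open>L_eq\<close> quantifies over all of \<open>F\<close>, so an actual
        element is required to compare the two equations.\<close>
      obtain f where "f \<in> F"
        using in_quotient_imp_non_empty[OF equiv F] by blast
      then have "L_op S (\<lambda>k. u k - w k) k = 0" for k
        using u(2) w(2) by (simp add: L_op_diff L_eq_def)
      moreover have "(u, w) \<in> psi_rel \<Psi>"
        using quotient_eq_iff[OF equiv Z Z u(1) w(1)] by simp
      then have "\<forall>k. \<Psi> k *v (u k - w k) = 0"
        by (simp add: psi_rel_iff[OF psd] matrix_vector_mult_diff_distrib)
      ultimately have "(\<lambda>k. u k - w k) = (\<lambda>k. 0)"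
        using D unfolding def_iff by blast
      then show "u = w" by (simp add: fun_eq_iff)
    qed
    \<comment> \<open>Existence is part of the definition of \<open>T_max\<close>.\<close>
    then show "\<forall>(Z, F) \<in> T_max S \<Psi>. \<exists>!u. u \<in> Z \<and> L_eq S \<Psi> u F"
      by (fastforce simp: T_max_def)
  next
    assume unique: "\<forall>(Z, F) \<in> T_max S \<Psi>. \<exists>!u. u \<in> Z \<and> L_eq S \<Psi> u F"
    \<comment> \<open>Uniqueness is used for one pair only, the zero class paired with itself: the
      representatives that it admits are exactly the null sequences with L(z) = 0.\<close>
    define N where "N = psi_rel \<Psi> `` {\<lambda>k. 0}"
    have zero: "(\<lambda>k. 0) \<in> ell2 \<Psi>"
      by (rule null_sequence_in_ell2[OF psd]) simp
    then have Nq: "N \<in> ell2_quot \<Psi>"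
      unfolding N_def ell2_quot_def by (rule quotientI)
    have N_iff: "z \<in> N \<longleftrightarrow> (\<forall>k. \<Psi> k *v z k = 0)" for z
      using zero null_sequence_in_ell2[OF psd, of z] by (auto simp: N_def psi_rel_iff[OF psd])
    have L_iff: "L_eq S \<Psi> z N \<longleftrightarrow> (\<forall>k. L_op S z k = 0)" for z
      by (subst L_eq_iff[OF psd Nq, of "\<lambda>k. 0"]) (simp_all add: N_iff)
    have L0: "L_op S (\<lambda>k. 0) k = 0" for k
      by (simp add: L_op_eq_0_iff)
    have "(N, N) \<in> T_max S \<Psi>"
      using Nq by (auto simp: T_max_def L_iff N_iff L0 intro!: bexI[of _ "\<lambda>k. 0"])
    with unique have "\<exists>!u. u \<in> N \<and> L_eq S \<Psi> u N" by blast
    \<comment> \<open>The zero sequence is one admissible representative, so uniqueness makes every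
      other one zero.\<close>
    moreover have "(\<lambda>k. 0) \<in> N \<and> L_eq S \<Psi> (\<lambda>k. 0) N"
      by (simp add: N_iff L_iff L0)
    ultimately show "definite_system S \<Psi>"
      unfolding def_iff L_iff[symmetric] N_iff[symmetric] by blast
  qed
qed

end
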